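(* Every 1-truth-table degree contains an $\mathrm{F_{REC}}$-rankable set.
   Context: All sets are subsets of $\Sigma^\ast$, $\Sigma=\{0,1\}$, ordered lexicographically by length then lexicographic order ($\epsilon<0<1<00<\cdots$). $\mathrm{F_{REC}}$ is the class of total recursive functions $\Sigma^\ast\to\Sigma^\ast$. A (possibly partial) function $f$ is a ranking function for $A$ if $f$ is defined on every element of $A$ and, for every $x\in A$, $f(x)$ is the $\|A^{\leq x}\|$-th string of $\Sigma^\ast$ in lexicographic order (counting from 1, so the first string is $\epsilon$), where $A^{\leq x}$ is the set of elements of $A$ lexicographically $\leq x$; i.e., if $x$ is the $i$th element of $A$ then $f(x)$ is the $i$th string of $\Sigma^\ast$. No condition is placed on $f$ outside $A$. $A$ is $\mathrm{F_{REC}}$-rankable if some $f\in\mathrm{F_{REC}}$ is a ranking function for $A$. $A \leq_{1\text{-}tt} B$ means $A$ is Turing reducible to $B$ via a recursive oracle machine halting on all inputs that makes at most one oracle query; 1-truth-table degrees are the equivalence classes of $\equiv_{1\text{-}tt}$ (mutual $\leq_{1\text{-}tt}$-reducibility). *)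

theory Defs
  imports Main "HOL-Library.List_Lenlexorder"
begin

(* Strings over {0,1} are lists of booleans (False = 0, True = 1).  List_Lenlexorder makes
   \<le> on them the length-then-lexicographic order [] < [False] < [True] < [False,False] < ... *)

type_synonym word = "bool list"

lemma finite_atMost_word: "finite {..x::word}"
proof (rule finite_subset)
  show "{..x} \<subseteq> {ys. set ys \<subseteq> UNIV \<and> length ys \<le> length x}"
    by (auto simp: list_le_def list_less_def dest: lenlex_length)
  show "finite {ys::word. set ys \<subseteq> UNIV \<and> length ys \<le> length x}"
    by (rule finite_lists_length_le) simp
qed


section \<open>Oracle Turing machines\<close>

(* Machines have one two-way infinite tape over {0,1,blank} (None is blank).  A tape is always
   described relative to the head, which scans cell 0.

   The state is an index into the list of instructions; the start state is 0, and every index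
   outside the list is a halting state, so each machine is a finite object.  A Step instruction
   reads the scanned symbol and gives the symbol to write, the head move and the next state.
   A Query instruction asks the oracle about the string on the tape that starts at the head
   and extends up to the first blank; the tape is left unchanged, and the next state is the first
   index if the answer is yes and the second one if it is no. *)

type_synonym tape = "int \<Rightarrow> bool option"

datatype move = Left | Right | Stay

datatype instr = Step "bool option \<Rightarrow> bool option \<times> move \<times> nat" | Query nat nat

type_synonym machine = "instr list"

type_synonym config = "nat \<times> tape"

fun offset :: "move \<Rightarrow> int" where
  "offset Left = -1"
| "offset Right = 1"
| "offset Stay = 0"

definition move_head :: "move \<Rightarrow> tape \<Rightarrow> tape" where
  "move_head m t = (\<lambda>i. t (i + offset m))"

definition input_tape :: "word \<Rightarrow> tape" where
  "input_tape x = (\<lambda>i. if 0 \<le> i \<and> i < int (length x) then Some (x ! nat i) else None)"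

(* Every tape reachable from an input tape has only finitely many nonblank cells, so the LEAST
   is attained. *)
definition scanned_word :: "tape \<Rightarrow> word" where
  "scanned_word t = map (\<lambda>i. the (t (int i))) [0..<(LEAST n. t (int n) = None)]"

fun exec :: "word set \<Rightarrow> instr \<Rightarrow> tape \<Rightarrow> config" where
  "exec B (Step f) t = (case f (t 0) of (s, m, q) \<Rightarrow> (q, move_head m (t(0 := s))))"
| "exec B (Query q1 q2) t = (if scanned_word t \<in> B then q1 else q2, t)"

definition next_config :: "machine \<Rightarrow> word set \<Rightarrow> config \<Rightarrow> config" where
  "next_config M B c = (if fst c < length M then exec B (M ! fst c) (snd c) else c)"

definition config_at :: "machine \<Rightarrow> word set \<Rightarrow> word \<Rightarrow> nat \<Rightarrow> config" where
  "config_at M B x k = (next_config M B ^^ k) (0, input_tape x)"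

definition halted_at :: "machine \<Rightarrow> word set \<Rightarrow> word \<Rightarrow> nat \<Rightarrow> bool" where
  "halted_at M B x k \<longleftrightarrow> fst (config_at M B x k) \<ge> length M"

definition halts :: "machine \<Rightarrow> word set \<Rightarrow> word \<Rightarrow> bool" where
  "halts M B x \<longleftrightarrow> (\<exists>k. halted_at M B x k)"

definition outputs :: "machine \<Rightarrow> word set \<Rightarrow> word \<Rightarrow> word \<Rightarrow> bool" where
  "outputs M B x y \<longleftrightarrow>
     (\<exists>k. halted_at M B x k \<and> scanned_word (snd (config_at M B x k)) = y)"

definition queries_at :: "machine \<Rightarrow> word set \<Rightarrow> word \<Rightarrow> nat \<Rightarrow> bool" where
  "queries_at M B x k \<longleftrightarrow>
     (let q = fst (config_at M B x k) in q < length M \<and> (\<exists>q1 q2. M ! q = Query q1 q2))"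

definition at_most_one_query :: "machine \<Rightarrow> word set \<Rightarrow> word \<Rightarrow> bool" where
  "at_most_one_query M B x \<longleftrightarrow>
     (\<forall>j k. queries_at M B x j \<longrightarrow> queries_at M B x k \<longrightarrow> j = k)"


section \<open>Total recursive functions and rankability\<close>

(* An ordinary Turing machine is a machine without Query instructions; the oracle {} is a dummy. *)
definition F_REC :: "(word \<Rightarrow> word) set" where
  "F_REC = {f. \<exists>M. (\<forall>q1 q2. Query q1 q2 \<notin> set M) \<and> (\<forall>x. outputs M {} x (f x))}"

(* The n-th string is the string with exactly n strings \<le> it, so that [] is the first one. *)
definition nth_word :: "nat \<Rightarrow> word" where
  "nth_word n = (THE y. card {..y} = n)"

definition ranking_function :: "(word \<Rightarrow> word option) \<Rightarrow> word set \<Rightarrow> bool" where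
  "ranking_function f A \<longleftrightarrow> (\<forall>x\<in>A. f x = Some (nth_word (card {y \<in> A. y \<le> x})))"

definition F_REC_rankable :: "word set \<Rightarrow> bool" where
  "F_REC_rankable A \<longleftrightarrow> (\<exists>f\<in>F_REC. ranking_function (\<lambda>x. Some (f x)) A)"


section \<open>1-truth-table reducibility and degrees\<close>

(* As usual for truth-table reductions, totality and the query bound are properties of the
   machine: they are required for every oracle C, not just for B. *)
definition one_tt_reducible :: "word set \<Rightarrow> word set \<Rightarrow> bool" (infix "\<le>\<^sub>1\<^sub>t\<^sub>t" 50) where
  "A \<le>\<^sub>1\<^sub>t\<^sub>t B \<longleftrightarrow>
     (\<exists>M. (\<forall>C x. halts M C x \<and> at_most_one_query M C x) \<and>
          (\<forall>x. outputs M B x [x \<in> A]))"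

definition one_tt_equiv :: "(word set \<times> word set) set" where
  "one_tt_equiv = {(A, B). A \<le>\<^sub>1\<^sub>t\<^sub>t B \<and> B \<le>\<^sub>1\<^sub>t\<^sub>t A}"

definition one_tt_degrees :: "word set set set" where
  "one_tt_degrees = UNIV // one_tt_equiv"

end

(* Given B, let A contain, for every word x, exactly one of x0 and x1: the word x1 if x \<in> B and
   the word x0 otherwise.  Either set is decided with one query to the other.  As the order compares
   xb and yc first by x and y, the word xb \<in> A has the same rank in A as x has among all words, so
   deleting the last symbol is a ranking function for A. *)

theory Submission
  imports Defs
begin

section \<open>Runs of machines\<close>

definition reaches :: "machine \<Rightarrow> word set \<Rightarrow> config \<Rightarrow> config \<Rightarrow> bool" where
  "reaches M C c c' \<longleftrightarrow> (\<exists>k. (next_config M C ^^ k) c = c')"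

lemma reaches_step: "next_config M C c = c' \<Longrightarrow> reaches M C c c'"
  unfolding reaches_def by (rule exI[of _ 1]) simp

lemma reaches_trans [trans]:
  assumes "reaches M C c d" and "reaches M C d e"
  shows "reaches M C c e"
proof -
  obtain k l where "(next_config M C ^^ k) c = d" and "(next_config M C ^^ l) d = e"
    using assms unfolding reaches_def by blast
  then have "(next_config M C ^^ (l + k)) c = e"
    by (simp add: funpow_add)
  then show ?thesis
    unfolding reaches_def by blast
qed

lemma outputsI:
  assumes "reaches M C (0, input_tape x) (q, t)" and "length M \<le> q" and "scanned_word t = y"
  shows "outputs M C x y"
  using assms unfolding outputs_def reaches_def halted_at_def config_at_def
  by (metis fst_conv snd_conv)

lemma outputs_halts: "outputs M C x y \<Longrightarrow> halts M C x"
  unfolding outputs_def halts_def by blast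

text \<open>If state indices never decrease along a run, a query ends in a state at or above
  \<open>N\<close>, and the run can never return to the states below \<open>N\<close>, where all
  queries sit.\<close>

lemma at_most_one_query_if_monotone:
  assumes mono: "\<And>q t. q < length M \<Longrightarrow> q \<le> fst (exec C (M ! q) t)"
    and query: "\<And>q q1 q2. q < length M \<Longrightarrow> M ! q = Query q1 q2 \<Longrightarrow> q < N \<and> N \<le> q1 \<and> N \<le> q2"
  shows "at_most_one_query M C x"
proof -
  let ?q = "\<lambda>k. fst (config_at M C x k)"
  have "?q k \<le> ?q (Suc k)" for k
    using mono by (simp add: config_at_def next_config_def)
  then have le: "?q j \<le> ?q k" if "j \<le> k" for j k
    using that by (rule lift_Suc_mono_le)
  have query_before: "?q k < N" if "queries_at M C x k" for k
    using that query unfolding queries_at_def by (metis (no_types))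
  have query_after: "N \<le> ?q (Suc k)" if k: "queries_at M C x k" for k
  proof -
    obtain q1 q2 where q: "?q k < length M" "M ! ?q k = Query q1 q2"
      using k by (auto simp: queries_at_def Let_def)
    have "?q (Suc k) = fst (exec C (M ! ?q k) (snd (config_at M C x k)))"
      using q(1) by (simp add: config_at_def next_config_def)
    then show ?thesis
      using query[OF q] q(2) by simp
  qed
  have "\<not> j < k" if "queries_at M C x j" "queries_at M C x k" for j k
    using le[of "Suc j" k] query_after[OF that(1)] query_before[OF that(2)] by auto
  then show ?thesis
    unfolding at_most_one_query_def by (metis linorder_neqE_nat)
qed


section \<open>Tapes carrying a word\<close>

text \<open>Since tapes are described relative to the head, moving the head along the written word
  \<open>x\<close> only changes the shift \<open>p\<close>, which is the position of the head in
  \<open>x\<close>.\<close>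

definition tape_at :: "word \<Rightarrow> int \<Rightarrow> tape" where
  "tape_at x p = (\<lambda>i. input_tape x (i + p))"

lemma tape_at_0: "tape_at x 0 = input_tape x"
  by (simp add: tape_at_def)

lemma move_head_tape_at: "move_head m (tape_at x p) = tape_at x (p + offset m)"
  by (simp add: move_head_def tape_at_def fun_eq_iff ac_simps)

lemma tape_at_eq_None_iff: "tape_at x p i = None \<longleftrightarrow> \<not> (0 \<le> i + p \<and> i + p < int (length x))"
  by (simp add: tape_at_def input_tape_def)

lemma tape_at_last: "tape_at (x @ [b]) (int (length x)) 0 = Some b"
  by (simp add: tape_at_def input_tape_def)

lemma tape_at_append:
  "(tape_at x (int (length x)))(0 := Some b) = tape_at (x @ [b]) (int (length x))"
  by (auto simp: tape_at_def input_tape_def fun_eq_iff nth_append)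

lemma tape_at_delete:
  "(tape_at (x @ [b]) (int (length x)))(0 := None) = tape_at x (int (length x))"
  by (auto simp: tape_at_def input_tape_def fun_eq_iff nth_append)

text \<open>Cells left of the head and beyond the first blank are left unconstrained, so machines
  may halt with remnants of the input there.\<close>

lemma scanned_word_eqI:
  assumes "\<And>i. i < length x \<Longrightarrow> t (int i) = Some (x ! i)" and "t (int (length x)) = None"
  shows "scanned_word t = x"
proof -
  have "(LEAST n. t (int n) = None) = length x"
    using assms by (intro Least_equality) (auto simp: not_less[symmetric])
  then show ?thesis
    unfolding scanned_word_def using assms(1) by (intro nth_equalityI) auto
qed

lemma scanned_word_input_tape: "scanned_word (input_tape x) = x"
  by (rule scanned_word_eqI) (auto simp: input_tape_def)


section \<open>Building blocks\<close>

text \<open>A loop when placed at index \<open>q\<close> of the machine: walk in direction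
  \<open>d\<close> up to the first blank, write \<open>w\<close> there, move by \<open>m\<close> and
  leave for state \<open>r\<close>.\<close>

definition scan :: "move \<Rightarrow> nat \<Rightarrow> bool option \<Rightarrow> move \<Rightarrow> nat \<Rightarrow> instr" where
  "scan d q w m r = Step (\<lambda>s. if s = None then (w, m, r) else (s, d, q))"

text \<open>Induction on the number \<open>n\<close> of nonblank cells passed; \<open>p\<close> is
  generalized because every pass shifts the head.\<close>

lemma reaches_scan:
  assumes "q < length M" and "M ! q = scan d q w m r"
    and "\<And>i. i < n \<Longrightarrow> tape_at x (p + int i * offset d) 0 \<noteq> None"
    and "tape_at x (p + int n * offset d) 0 = None"
  shows "reaches M C (q, tape_at x p)
    (r, move_head m ((tape_at x (p + int n * offset d))(0 := w)))"
  using assms(3,4)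
proof (induction n arbitrary: p)
  case 0
  then show ?case
    using assms(1,2) by (intro reaches_step) (simp add: next_config_def scan_def fun_upd_def)
next
  case (Suc n)
  let ?p = "p + offset d"
  obtain b where "tape_at x p 0 = Some b"
    using Suc.prems(1)[of 0] by auto
  then have "reaches M C (q, tape_at x p) (q, tape_at x ?p)"
    using assms(1,2)
    by (intro reaches_step) (simp add: next_config_def scan_def fun_upd_idem move_head_tape_at)
  also have "reaches M C (q, tape_at x ?p)
      (r, move_head m ((tape_at x (?p + int n * offset d))(0 := w)))"
  proof (rule Suc.IH)
    show "tape_at x (?p + int i * offset d) 0 \<noteq> None" if "i < n" for i
      using Suc.prems(1)[of "Suc i"] that by (simp add: algebra_simps)
    show "tape_at x (?p + int n * offset d) 0 = None"
      using Suc.prems(2) by (simp add: algebra_simps)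
  qed
  finally show ?case
    by (simp add: algebra_simps fun_upd_def)
qed

lemma reaches_scan_right:
  assumes "q < length M" and "M ! q = scan Right q w m r"
  shows "reaches M C (q, input_tape x)
    (r, move_head m ((tape_at x (int (length x)))(0 := w)))"
  using reaches_scan[OF assms, where n = "length x" and x = x and p = 0 and C = C]
  by (simp add: tape_at_0 tape_at_eq_None_iff)

text \<open>Rewinds the head: the blank at position -1 stops the walk and the final move right leads
  to position 0. Allowing \<open>p = -1\<close> covers the empty word.\<close>

lemma reaches_scan_left:
  assumes "q < length M" and "M ! q = scan Left q None Right r"
    and "p < int (length x)" and "-1 \<le> p"
  shows "reaches M C (q, tape_at x p) (r, input_tape x)"
proof -
  have "(tape_at x (-1))(0 := None) = tape_at x (-1)"
    using tape_at_eq_None_iff[of x "-1" 0] by auto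
  \<comment> \<open>The nonblank cells passed are those at positions \<open>p\<close> down to 0,
    hence \<open>nat (p + 1)\<close> many.\<close>
  then show ?thesis
    using reaches_scan[OF assms(1,2), where n = "nat (p + 1)" and x = x and p = p and C = C] assms(3,4)
    by (auto simp: tape_at_eq_None_iff move_head_tape_at tape_at_0)
qed

lemma reaches_query:
  assumes "q < length M" and "M ! q = Query q1 q2"
  shows "reaches M C (q, input_tape x) (if x \<in> C then q1 else q2, input_tape x)"
  using assms by (intro reaches_step) (simp add: next_config_def scanned_word_input_tape)

definition erase :: "nat \<Rightarrow> instr" where
  "erase r = Step (\<lambda>_. (None, Left, r))"

definition answer :: "bool \<Rightarrow> nat \<Rightarrow> instr" where
  "answer b r = Step (\<lambda>_. (Some b, Stay, r))"

(* Only cell 0 is blanked: once the head is left of it, the rest of the old word is cut off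
   from the output. *)
lemma outputs_answer:
  assumes "reaches M C (0, input_tape x) (q, t)"
    and "q < length M" and "M ! q = erase q'"
    and "q' < length M" and "M ! q' = answer b r" and "length M \<le> r"
  shows "outputs M C x [b]"
proof -
  define t' where "t' = move_head Left (t(0 := None))"
  note assms(1)
  also have "reaches M C (q, t) (q', t')"
    using assms(2,3) by (intro reaches_step) (simp add: next_config_def erase_def t'_def)
  also have "reaches M C (q', t') (r, t'(0 := Some b))"
    using assms(4,5)
    by (intro reaches_step) (simp add: next_config_def answer_def move_head_def fun_eq_iff)
  finally have "reaches M C (0, input_tape x) (r, t'(0 := Some b))" .
  \<comment> \<open>The erased cell is now cell 1 and ends the output right after
    \<open>b\<close>.\<close>
  moreover have "scanned_word (t'(0 := Some b)) = [b]"
    by (rule scanned_word_eqI) (simp_all add: t'_def move_head_def)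
  ultimately show ?thesis
    using assms(6) outputsI by blast
qed


section \<open>Machines for the ranking function and the reductions\<close>

text \<open>Go to the last symbol, erase it, rewind; state 3 lies outside the list and
  halts.\<close>

definition butlast_machine :: machine where
  "butlast_machine = [scan Right 0 None Left 1, erase 2, scan Left 2 None Right 3]"

lemma outputs_butlast_machine: "outputs butlast_machine C x (butlast x)"
proof -
  let ?M = butlast_machine
  have "reaches ?M C (0, input_tape x)
      (1, move_head Left ((tape_at x (int (length x)))(0 := None)))"
    by (rule reaches_scan_right) (simp_all add: butlast_machine_def)
  also have "(tape_at x (int (length x)))(0 := None) = tape_at x (int (length x))"
    using tape_at_eq_None_iff[of x "int (length x)" 0] by auto
  also have "reaches ?M C (1, move_head Left (tape_at x (int (length x))))
      (2, move_head Left ((tape_at x (int (length x) - 1))(0 := None)))"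
    by (rule reaches_step)
      (simp add: next_config_def butlast_machine_def erase_def move_head_tape_at)
  finally have run: "reaches ?M C (0, input_tape x)
      (2, move_head Left ((tape_at x (int (length x) - 1))(0 := None)))" .
  show ?thesis
  proof (cases x rule: rev_cases)
    case Nil
    \<comment> \<open>On empty input the head enters state 2 at position -2, out of reach of
      \<open>reaches_scan_left\<close>; but the whole tape is blank, so one step is computed
      directly.\<close>
    let ?t = "\<lambda>_. None"
    have "move_head Left ((tape_at x (int (length x) - 1))(0 := None)) = ?t"
      using Nil by (auto simp: move_head_def tape_at_def input_tape_def fun_eq_iff)
    with run have "reaches ?M C (0, input_tape x) (2, ?t)"
      by simp
    also have "reaches ?M C (2, ?t) (3, ?t)"
      by (rule reaches_step)
        (simp add: next_config_def butlast_machine_def scan_def move_head_def fun_eq_iff)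
    finally show ?thesis
      by (rule outputsI) (auto simp: butlast_machine_def Nil intro!: scanned_word_eqI)
  next
    case (snoc y b)
    have "move_head Left ((tape_at x (int (length x) - 1))(0 := None)) = tape_at y (int (length y) - 1)"
      using snoc by (simp add: tape_at_delete move_head_tape_at)
    with run have "reaches ?M C (0, input_tape x) (2, tape_at y (int (length y) - 1))"
      by simp
    also have "reaches ?M C (2, tape_at y (int (length y) - 1)) (3, input_tape y)"
      by (rule reaches_scan_left) (simp_all add: butlast_machine_def)
    finally show ?thesis
      by (rule outputsI) (simp_all add: butlast_machine_def snoc scanned_word_input_tape)
  qed
qed

lemma butlast_in_F_REC: "butlast \<in> F_REC"
proof -
  have "Query q1 q2 \<notin> set butlast_machine" for q1 q2
    by (simp add: butlast_machine_def scan_def erase_def)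
  then show ?thesis
    unfolding F_REC_def using outputs_butlast_machine by blast
qed

text \<open>Write a 1 behind the input, rewind and query. States 3 and 4 then answer yes, 5 and 6
  answer no. The numbering makes every transition nondecreasing.\<close>

definition append_True_machine :: machine where
  "append_True_machine =
    [scan Right 0 (Some True) Left 1, scan Left 1 None Right 2, Query 3 5,
     erase 4, answer True 7, erase 6, answer False 7]"

lemma outputs_append_True_machine: "outputs append_True_machine C x [x @ [True] \<in> C]"
proof -
  let ?M = append_True_machine and ?y = "x @ [True]"
  have "reaches ?M C (0, input_tape x)
      (1, move_head Left ((tape_at x (int (length x)))(0 := Some True)))"
    by (rule reaches_scan_right) (simp_all add: append_True_machine_def)
  also have "move_head Left ((tape_at x (int (length x)))(0 := Some True)) =
      tape_at ?y (int (length x) - 1)"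
    by (simp add: tape_at_append move_head_tape_at)
  also have "reaches ?M C (1, tape_at ?y (int (length x) - 1)) (2, input_tape ?y)"
    by (rule reaches_scan_left) (simp_all add: append_True_machine_def)
  also have "reaches ?M C (2, input_tape ?y) (if ?y \<in> C then 3 else 5, input_tape ?y)"
    by (rule reaches_query) (simp_all add: append_True_machine_def)
  finally have "reaches ?M C (0, input_tape x) (if ?y \<in> C then 3 else 5, input_tape ?y)" .
  then show ?thesis
    using outputs_answer[of ?M C x 3 _ 4 True 7] outputs_answer[of ?M C x 5 _ 6 False 7]
    by (auto simp: append_True_machine_def split: if_splits)
qed

text \<open>The only query is in state 2 and leads to state 3 or 5, whence
  \<open>N = 3\<close>.\<close>

lemma at_most_one_query_append_True_machine: "at_most_one_query append_True_machine C x"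
  by (rule at_most_one_query_if_monotone[where N = 3])
    (auto simp: append_True_machine_def scan_def erase_def answer_def less_Suc_eq numeral_eq_Suc)

(* The last input symbol selects state 2 or 3 and is thereby remembered across the query. *)
definition compare_last_machine :: machine where
  "compare_last_machine =
    [scan Right 0 None Left 1,
     Step (\<lambda>s. case s of None \<Rightarrow> (Some False, Stay, 10)
                        | Some b \<Rightarrow> (None, Left, if b then 3 else 2)),
     scan Left 2 None Right 4, scan Left 3 None Right 5, Query 8 6, Query 6 8,
     erase 7, answer True 10, erase 9, answer False 10]"

text \<open>States 4 and 5 ask the same question with opposite targets, so state 6 is reached
  exactly when the erased symbol agrees with the oracle's answer. The empty word is rejected in
  state 1, before any query.\<close>

lemma outputs_compare_last_machine:
  "outputs compare_last_machine C x [x \<noteq> [] \<and> last x = (butlast x \<in> C)]"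
proof -
  let ?M = compare_last_machine
  have "reaches ?M C (0, input_tape x)
      (1, move_head Left ((tape_at x (int (length x)))(0 := None)))"
    by (rule reaches_scan_right) (simp_all add: compare_last_machine_def)
  also have "(tape_at x (int (length x)))(0 := None) = tape_at x (int (length x))"
    using tape_at_eq_None_iff[of x "int (length x)" 0] by auto
  finally have run: "reaches ?M C (0, input_tape x) (1, tape_at x (int (length x) - 1))"
    by (simp add: move_head_tape_at)
  show ?thesis
  proof (cases x rule: rev_cases)
    case Nil
    let ?t = "tape_at [] (-1)"
    have "reaches ?M C (0, input_tape x) (1, ?t)"
      using run Nil by simp
    also have "reaches ?M C (1, ?t) (10, ?t(0 := Some False))"
      using tape_at_eq_None_iff[of "[]" "-1" 0]
      by (intro reaches_step) (simp add: next_config_def compare_last_machine_def move_head_def fun_eq_iff)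
    finally have "outputs ?M C x [False]"
      by (rule outputsI) (auto simp: compare_last_machine_def tape_at_eq_None_iff intro!: scanned_word_eqI)
    then show ?thesis
      using Nil by simp
  next
    case (snoc y b)
    let ?q = "if b then 3 else 2 :: nat" and ?r = "if b then 5 else 4 :: nat"
    let ?s = "if b = (y \<in> C) then 6 else 8 :: nat"
    have "reaches ?M C (0, input_tape x) (1, tape_at (y @ [b]) (int (length y)))"
      using run snoc by simp
    also have "reaches ?M C (1, tape_at (y @ [b]) (int (length y))) (?q, tape_at y (int (length y) - 1))"
      by (intro reaches_step)
        (simp add: next_config_def compare_last_machine_def tape_at_last tape_at_delete move_head_tape_at)
    also have "reaches ?M C (?q, tape_at y (int (length y) - 1)) (?r, input_tape y)"
      by (rule reaches_scan_left) (simp_all add: compare_last_machine_def)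
    also have "reaches ?M C (?r, input_tape y)
        (if y \<in> C then if b then 6 else 8 else if b then 8 else 6, input_tape y)"
      by (rule reaches_query) (simp_all add: compare_last_machine_def)
    also have "(if y \<in> C then if b then 6 else 8 else if b then 8 else 6) = ?s"
      by simp
    finally have "reaches ?M C (0, input_tape x) (?s, input_tape y)" .
    then have "outputs ?M C x [b = (y \<in> C)]"
      using outputs_answer[of ?M C x 8 _ 9 False 10] outputs_answer[of ?M C x 6 _ 7 True 10]
      by (auto simp: compare_last_machine_def split: if_splits)
    then show ?thesis
      using snoc by simp
  qed
qed

text \<open>Both query states, 4 and 5, lead directly to 6 or 8, whence \<open>N = 6\<close>; no run
  passes through both.\<close>

lemma at_most_one_query_compare_last_machine: "at_most_one_query compare_last_machine C x"
  by (rule at_most_one_query_if_monotone[where N = 6])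
    (auto simp: compare_last_machine_def scan_def erase_def answer_def less_Suc_eq numeral_eq_Suc
      split: option.split)


section \<open>A rankable set in every degree\<close>

text \<open>Picks the one of x0 and x1 that is put into the rankable set, which is therefore
  \<open>range (select B)\<close>.\<close>

definition select :: "word set \<Rightarrow> word \<Rightarrow> word" where
  "select B x = x @ [x \<in> B]"

lemma append_in_range_select_iff: "x @ [b] \<in> range (select B) \<longleftrightarrow> b = (x \<in> B)"
  by (auto simp: select_def)

lemma in_range_select_iff: "x \<in> range (select B) \<longleftrightarrow> x \<noteq> [] \<and> last x = (butlast x \<in> B)"
  by (cases x rule: rev_cases) (auto simp: append_in_range_select_iff, simp add: select_def)

lemma range_select_reducible: "range (select B) \<le>\<^sub>1\<^sub>t\<^sub>t B"
  unfolding one_tt_reducible_def in_range_select_iff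
  using outputs_compare_last_machine at_most_one_query_compare_last_machine outputs_halts by blast

lemma reducible_range_select: "B \<le>\<^sub>1\<^sub>t\<^sub>t range (select B)"
proof -
  have "outputs append_True_machine (range (select B)) x [x \<in> B]" for x
    using outputs_append_True_machine[of "range (select B)" x]
    by (simp add: append_in_range_select_iff)
  then show ?thesis
    unfolding one_tt_reducible_def
    using outputs_append_True_machine at_most_one_query_append_True_machine outputs_halts by blast
qed

text \<open>Initial segments are finite and comparable by inclusion, so their cardinality determines
  them and thereby their greatest element.\<close>

lemma nth_word_card: "nth_word (card {..y}) = y"
  unfolding nth_word_def
proof (rule the_equality)
  fix z :: word
  assume eq: "card {..z} = card {..y}"
  have "{..z} \<subseteq> {..y} \<or> {..y} \<subseteq> {..z}"
    using linear[of z y] by auto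
  then have "{..z} = {..y}"
    using eq finite_atMost_word card_subset_eq by metis
  then show "z = y"
    by simp
qed simp

text \<open>Either \<open>x\<close> is shorter and stays so, or the lengths agree and the first
  difference lies before the appended symbols; hence \<open>b\<close> and \<open>c\<close> are
  arbitrary.\<close>

lemma append_single_less:
  fixes x y :: word
  assumes "x < y"
  shows "x @ [b] < y @ [c]"
  using assms
  by (auto simp: list_less_def lenlex_conv intro: lex_append_rightI)

lemma strict_mono_select: "strict_mono (select B)"
  by (simp add: strict_mono_def select_def append_single_less)

lemma ranking_function_butlast: "ranking_function (\<lambda>x. Some (butlast x)) (range (select B))"
  unfolding ranking_function_def
proof
  fix x
  assume "x \<in> range (select B)"
  then obtain y where x: "x = select B y"
    by blast
  \<comment> \<open>A strictly increasing map on a linear order also reflects \<le>, so the elements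
    up to \<open>select B y\<close> are exactly the images of the words up to
    \<open>y\<close>.\<close>
  have "{z \<in> range (select B). z \<le> x} = select B ` {..y}"
    using strict_mono_less_eq[OF strict_mono_select[of B]] x by auto
  moreover have "inj_on (select B) {..y}"
    using inj_on_subset[OF strict_mono_imp_inj_on[OF strict_mono_select]] by blast
  ultimately have "card {z \<in> range (select B). z \<le> x} = card {..y}"
    by (simp add: card_image)
  then show "Some (butlast x) = Some (nth_word (card {z \<in> range (select B). z \<le> x}))"
    by (simp add: nth_word_card x select_def)
qed

theorem theorem6:
  shows "\<forall>D \<in> one_tt_degrees. \<exists>A \<in> D. F_REC_rankable A"
proof
  fix D
  assume "D \<in> one_tt_degrees"
  then obtain B where "D = one_tt_equiv `` {B}"
    unfolding one_tt_degrees_def by (rule quotientE)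
  then have "range (select B) \<in> D"
    using range_select_reducible reducible_range_select by (simp add: one_tt_equiv_def)
  moreover have "F_REC_rankable (range (select B))"
    unfolding F_REC_rankable_def using butlast_in_F_REC ranking_function_butlast by blast
  ultimately show "\<exists>A \<in> D. F_REC_rankable A"
    by blast
qed

end
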